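(* Let $k$ be a positive integer and let $\mathcal{C}$ be a self-dual $\mathbb{Z}_4$-code of length $24k$. Suppose that the minimum Lee weight of $\mathcal{C}$ is $8k+4$ or $8k+2$. Then the residue code $\mathcal{C}^{(1)}$ is a binary extremal doubly even self-dual code of length $24k$.
   Context: A $\mathbb{Z}_4$-code of length $n$ is a $\mathbb{Z}_4$-submodule $\mathcal{C}$ of $\mathbb{Z}_4^n$, where $\mathbb{Z}_4=\{0,1,2,3\}$ is the ring of integers modulo $4$. Its dual is $\mathcal{C}^\perp=\{x\in\mathbb{Z}_4^n \mid x\cdot y=0 \text{ for all } y\in\mathcal{C}\}$, with $x\cdot y$ the standard inner product; $\mathcal{C}$ is self-dual if $\mathcal{C}=\mathcal{C}^\perp$. For $x\in\mathbb{Z}_4^n$ let $n_i(x)$ be the number of components of $x$ equal to $i$. The Lee weight of $x$ is $n_1(x)+2n_2(x)+n_3(x)$, and the minimum Lee weight of $\mathcal{C}$ is the smallest Lee weight among all non-zero codewords of $\mathcal{C}$. The residue code of $\mathcal{C}$ is the binary code $\mathcal{C}^{(1)}=\{c \bmod 2 \mid c\in\mathcal{C}\}$. A binary code is a linear subspace of $\mathbb{Z}_2^n$; it is self-dual if it equals its dual under the standard inner product, and doubly even if all its codewords have Hamming weight divisible by $4$. A binary self-dual code of length $n$ is extremal if its minimum weight equals $4\lfloor n/24\rfloor+6$ when $n\equiv 22 \pmod{24}$, and $4\lfloor n/24\rfloor+4$ otherwise. Thus an extremal code of length $24k$ has minimum weight $4k+4$. *)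

theory Defs
  imports "HOL-Analysis.Analysis" "HOL-Library.Z2"
begin

text \<open>
  Codes of length \<open>n\<close> over a ring \<open>'a\<close> are sets of vectors in \<open>'a ^ 'n\<close>, where
  \<open>n = CARD('n)\<close>.  The ring \<open>Z\<^sub>4\<close> is the numeral type \<open>4\<close>, the field \<open>Z\<^sub>2\<close> is \<^typ>\<open>bit\<close>.
\<close>

type_synonym z4 = 4

lemma module_vector_scalar_mult:
  "module ((*s) :: 'a::comm_ring_1 \<Rightarrow> 'a ^ 'n \<Rightarrow> 'a ^ 'n)"
  by unfold_locales (simp_all add: vec_eq_iff algebra_simps)

text \<open>A submodule for \<open>'a = z4\<close>, a linear subspace for \<open>'a = bit\<close>.\<close>

definition linear_code :: "('a::comm_ring_1 ^ 'n) set \<Rightarrow> bool" where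
  "linear_code C \<longleftrightarrow> module.subspace (*s) C"

definition dot :: "'a::comm_ring_1 ^ 'n \<Rightarrow> 'a ^ 'n \<Rightarrow> 'a" where
  "dot x y = (\<Sum>i\<in>UNIV. x $ i * y $ i)"

definition dual_code :: "('a::comm_ring_1 ^ 'n) set \<Rightarrow> ('a ^ 'n) set" where
  "dual_code C = {x. \<forall>y\<in>C. dot x y = 0}"

definition self_dual :: "('a::comm_ring_1 ^ 'n) set \<Rightarrow> bool" where
  "self_dual C \<longleftrightarrow> linear_code C \<and> C = dual_code C"

definition num_comps :: "'a \<Rightarrow> 'a ^ 'n \<Rightarrow> nat" where
  "num_comps a x = card {i. x $ i = a}"

definition lee_weight :: "z4 ^ 'n \<Rightarrow> nat" where
  "lee_weight x = num_comps 1 x + 2 * num_comps 2 x + num_comps 3 x"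

definition hamming_weight :: "bit ^ 'n \<Rightarrow> nat" where
  "hamming_weight x = card {i. x $ i \<noteq> 0}"

text \<open>
  The two minimum weights are unspecified for the zero code, which is never self-dual
  because index types are nonempty.
\<close>

definition min_lee_weight :: "(z4 ^ 'n) set \<Rightarrow> nat" where
  "min_lee_weight C = Min (lee_weight ` (C - {0}))"

definition min_hamming_weight :: "(bit ^ 'n) set \<Rightarrow> nat" where
  "min_hamming_weight B = Min (hamming_weight ` (B - {0}))"

text \<open>\<^const>\<open>Rep_bit0\<close> maps an element of \<^typ>\<open>z4\<close> to its representative in \<open>{0, 1, 2, 3}\<close>.\<close>

definition mod2 :: "z4 \<Rightarrow> bit" where
  "mod2 a = of_int (Rep_bit0 a)"

lemma mod2_simps [simp]: "mod2 0 = 0" "mod2 1 = 1" "mod2 2 = 0" "mod2 3 = 1"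
  by (simp_all add: mod2_def bit0.Rep_0 bit0.Rep_1 bit0.Rep_numeral)

definition residue_code :: "(z4 ^ 'n) set \<Rightarrow> (bit ^ 'n) set" where
  "residue_code C = (\<lambda>c. \<chi> i. mod2 (c $ i)) ` C"

definition doubly_even :: "(bit ^ 'n) set \<Rightarrow> bool" where
  "doubly_even B \<longleftrightarrow> linear_code B \<and> (\<forall>x\<in>B. 4 dvd hamming_weight x)"

definition extremal :: "(bit ^ 'n) set \<Rightarrow> bool" where
  "extremal B \<longleftrightarrow> self_dual B \<and>
     min_hamming_weight B =
       (if CARD('n) mod 24 = 22 then 4 * (CARD('n) div 24) + 6
        else 4 * (CARD('n) div 24) + 4)"

end

theory Submission
  imports Defs "HOL-Computational_Algebra.Formal_Laurent_Series"
begin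

text \<open>
  The residue code \<open>B\<close> of \<open>C\<close> is doubly even, and its dual is the torsion code
  \<open>{y. 2y \<in> C}\<close>, whose minimum weight is at least \<open>4k + 1\<close> by the hypothesis on Lee weights.
  Since \<open>8\<close> divides the length, \<open>B\<close> lies in a doubly even self-dual code \<open>D\<close>.  Then
  \<open>D \<subseteq> B\<^sup>\<bottom>\<close>, so \<open>D\<close> has minimum weight at least \<open>4k + 4\<close> and at most \<open>4k\<close> nonzero weights.
  By Delsarte's bound its covering radius is at most \<open>4k\<close>.  A word of \<open>B\<^sup>\<bottom>\<close> outside \<open>D\<close> would
  therefore give a nonzero word of \<open>B\<^sup>\<bottom>\<close> of weight at most \<open>4k\<close>.  Hence \<open>B\<^sup>\<bottom> = D\<close>, that is
  \<open>B = D\<close>, and \<open>D\<close> is extremal by the Mallows-Sloane bound.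
\<close>

unbundle no Formal_Power_Series.fps_syntax

text \<open>These default rules rewrite the field operations of \<^typ>\<open>bit\<close> to bitwise ones.\<close>

declare add_bit_eq_xor [simp del] mult_bit_eq_and [simp del]

subsection \<open>Binary linear codes\<close>

lemma UNIV_bit: "(UNIV :: bit set) = {0, 1}"
  using bit.exhaust by auto

lemma bit_add_self [simp]: "(b :: bit) + b = 0"
  by (cases b) auto

lemma bit_vec_add_self [simp]: "(x :: bit ^ 'n) + x = 0"
  by (simp add: vec_eq_iff)

lemma bit_vec_add_cancel [simp]: "(x :: bit ^ 'n) + (x + y) = y"
  by (simp add: add.assoc [symmetric])

lemma dot_zero_left [simp]: "dot 0 x = 0"
  by (simp add: dot_def)

lemma dot_zero_right [simp]: "dot x 0 = 0"
  by (simp add: dot_def)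

lemma dot_add_left: "dot (x + y) z = dot x z + dot y z"
  by (simp add: dot_def algebra_simps sum.distrib)

lemma dot_commute: "dot x y = dot y x"
  by (simp add: dot_def mult.commute)

lemma dot_add_right: "dot z (x + y) = dot z x + dot z y"
  by (metis dot_commute dot_add_left)

lemma dot_scale_left: "dot (a *s x) y = a * dot x y"
  by (simp add: dot_def sum_distrib_left mult.assoc)

lemma linear_code_dual: "linear_code (dual_code B)"
  unfolding linear_code_def module.subspace_def[OF module_vector_scalar_mult]
  by (auto simp: dual_code_def dot_add_left dot_scale_left)

lemma linear_code_bit:
  "linear_code (B :: (bit ^ 'n) set) \<longleftrightarrow> 0 \<in> B \<and> (\<forall>x\<in>B. \<forall>y\<in>B. x + y \<in> B)"
proof -
  have "c *s x = 0 \<or> c *s x = x" for c and x :: "bit ^ 'n"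
    by (cases c) (auto simp: vec_eq_iff)
  then show ?thesis
    unfolding linear_code_def module.subspace_def[OF module_vector_scalar_mult]
    by metis
qed

section \<open>The additive character of \<open>bit\<close> and the MacWilliams identity\<close>

definition bit_sign :: "bit \<Rightarrow> 'a::comm_ring_1" where
  "bit_sign b = (if b = 0 then 1 else - 1)"

lemma bit_sign_0 [simp]: "bit_sign 0 = 1" and bit_sign_1 [simp]: "bit_sign 1 = - 1"
  by (simp_all add: bit_sign_def)

lemma bit_sign_add: "bit_sign (a + b) = bit_sign a * bit_sign b"
  by (cases a; cases b) simp_all

lemma bit_sign_sum: "bit_sign (\<Sum>i\<in>A. f i) = (\<Prod>i\<in>A. bit_sign (f i))"
  by (induction A rule: infinite_finite_induct) (simp_all add: bit_sign_add)

text \<open>Summed over a code this is the homogeneous weight enumerator. The ring stays generic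
  because integers, complex numbers and real polynomials are all substituted.\<close>

definition weight_monom :: "'a::comm_ring_1 \<Rightarrow> 'a \<Rightarrow> bit ^ 'n \<Rightarrow> 'a" where
  "weight_monom X Y v = X ^ (CARD('n) - hamming_weight v) * Y ^ hamming_weight v"

lemma weight_monom_prod:
  fixes v :: "bit ^ 'n"
  shows "weight_monom X Y v = (\<Prod>i\<in>UNIV. if v $ i = 0 then X else Y)"
proof -
  have "card {i. v $ i = 0} = CARD('n) - hamming_weight v"
    unfolding hamming_weight_def
    by (subst card_Diff_subset[symmetric]) (auto intro: arg_cong[where f=card])
  then show ?thesis
    by (simp add: prod.If_cases weight_monom_def hamming_weight_def Compl_eq)
qed

lemma sum_prod_bit_vec:
  fixes f :: "'n::finite \<Rightarrow> bit \<Rightarrow> 'a::comm_ring_1"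
  shows "(\<Sum>v\<in>UNIV. \<Prod>i\<in>UNIV. f i (v $ i)) = (\<Prod>i\<in>UNIV. f i 0 + f i 1)"
proof -
  have "(\<Prod>i\<in>UNIV. f i 0 + f i 1) = (\<Prod>i\<in>UNIV. \<Sum>b\<in>UNIV. f i b)"
    by (simp add: UNIV_bit)
  also have "\<dots> = (\<Sum>g\<in>UNIV \<rightarrow>\<^sub>E UNIV. \<Prod>i\<in>UNIV. f i (g i))"
    by (intro prod_sum_PiE) (auto simp: UNIV_bit)
  also have "\<dots> = (\<Sum>v\<in>UNIV. \<Prod>i\<in>UNIV. f i (v $ i))"
    by (rule sum.reindex_bij_witness[of _ vec_nth vec_lambda]) (auto simp: PiE_UNIV_domain)
  finally show ?thesis ..
qed

lemma finite_bit_vec [simp]: "finite (B :: (bit ^ 'n) set)"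
proof -
  have "finite (vec_lambda ` (UNIV \<rightarrow>\<^sub>E (UNIV :: bit set)) :: (bit ^ 'n) set)"
    by (intro finite_imageI finite_PiE) (auto simp: UNIV_bit)
  moreover have "v \<in> vec_lambda ` (UNIV \<rightarrow>\<^sub>E UNIV)" for v :: "bit ^ 'n"
    by (rule image_eqI[of _ _ "vec_nth v"]) (auto simp: PiE_UNIV_domain)
  ultimately show ?thesis
    by (metis finite_subset subsetI)
qed

text \<open>The Fourier transform factors over the coordinates: each contributes
  \<open>X + Y\<close> or \<open>X - Y\<close> according to \<open>d $ i\<close>.\<close>

lemma sum_sign_weight_monom:
  "(\<Sum>v\<in>UNIV. bit_sign (dot d v) * weight_monom X Y v) = weight_monom (X + Y) (X - Y) d"
proof -
  have "(\<Sum>v\<in>UNIV. bit_sign (dot d v) * weight_monom X Y v) =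
        (\<Sum>v\<in>UNIV. \<Prod>i\<in>UNIV. bit_sign (d $ i * v $ i) * (if v $ i = 0 then X else Y))"
    by (simp add: dot_def bit_sign_sum weight_monom_prod prod.distrib)
  also have "\<dots> = (\<Prod>i\<in>UNIV. bit_sign (d $ i * 0) * (if (0::bit) = 0 then X else Y) +
                     bit_sign (d $ i * 1) * (if (1::bit) = 0 then X else Y))"
    by (rule sum_prod_bit_vec)
  also have "\<dots> = weight_monom (X + Y) (X - Y) d"
    unfolding weight_monom_prod by (intro prod.cong) (auto simp: bit_sign_def)
  finally show ?thesis .
qed

text \<open>Character orthogonality: if some \<open>e\<close> in \<open>B\<close> has
  \<open>dot e w = 1\<close>, translation by \<open>e\<close> negates the sum.\<close>

lemma sum_sign_code:
  assumes "linear_code B"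
  shows "(\<Sum>d\<in>B. bit_sign (dot d w)) =
         (if w \<in> dual_code B then of_nat (card B) else (0 :: 'a::{idom,ring_char_0}))"
proof (cases "w \<in> dual_code B")
  case True
  then have "dot d w = 0" if "d \<in> B" for d
    using that by (auto simp: dual_code_def dot_commute)
  then show ?thesis
    using True by simp
next
  case False
  then obtain e where e: "e \<in> B" "dot e w = 1"
    by (auto simp: dual_code_def dot_commute)
  let ?S = "\<Sum>d\<in>B. bit_sign (dot d w) :: 'a"
  have "?S = (\<Sum>d\<in>B. bit_sign (dot (e + d) w))"
    by (rule sum.reindex_bij_witness[of _ "(+) e" "(+) e"])
       (use assms e in \<open>auto simp: linear_code_bit\<close>)
  also have "\<dots> = - ?S"
    by (simp add: dot_add_left bit_sign_add e sum_negf)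
  finally have "?S = 0"
    by simp
  then show ?thesis
    using False by simp
qed

text \<open>Poisson summation: expand by \<open>sum_sign_weight_monom\<close>, swap the sums, apply
  \<open>sum_sign_code\<close>. The case \<open>x = 0\<close> is the usual MacWilliams identity;
  general \<open>x\<close> gives the weight enumerator of a coset of the dual.\<close>

lemma macwilliams_coset:
  fixes X Y :: "'a::{idom,ring_char_0}"
  assumes "linear_code B"
  shows "(\<Sum>d\<in>B. bit_sign (dot d x) * weight_monom (X + Y) (X - Y) d) =
         of_nat (card B) * (\<Sum>v\<in>{v. v + x \<in> dual_code B}. weight_monom X Y v)"
proof -
  have "(\<Sum>d\<in>B. bit_sign (dot d x) * weight_monom (X + Y) (X - Y) d) =
        (\<Sum>d\<in>B. \<Sum>v\<in>UNIV. bit_sign (dot d (v + x)) * weight_monom X Y v)"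
    by (simp add: sum_sign_weight_monom[symmetric] sum_distrib_left dot_add_right bit_sign_add mult_ac)
  also have "\<dots> = (\<Sum>v\<in>UNIV. (\<Sum>d\<in>B. bit_sign (dot d (v + x))) * weight_monom X Y v)"
    by (subst sum.swap) (simp add: sum_distrib_right)
  also have "\<dots> = (\<Sum>v\<in>UNIV. if v + x \<in> dual_code B then of_nat (card B) * weight_monom X Y v else 0)"
    by (intro sum.cong) (auto simp: sum_sign_code[OF assms])
  also have "\<dots> = of_nat (card B) * (\<Sum>v\<in>{v. v + x \<in> dual_code B}. weight_monom X Y v)"
    by (simp add: sum_distrib_left sum.If_cases)
  finally show ?thesis .
qed

lemma hamming_weight_le: "hamming_weight (x :: bit ^ 'n) \<le> CARD('n)"
  unfolding hamming_weight_def by (rule card_mono) auto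

lemma hamming_weight_0 [simp]: "hamming_weight 0 = 0"
  by (simp add: hamming_weight_def)

lemma hamming_weight_eq_0_iff: "hamming_weight x = 0 \<longleftrightarrow> x = 0"
proof -
  have "hamming_weight x = 0 \<longleftrightarrow> {i. x $ i \<noteq> 0} = {}"
    unfolding hamming_weight_def by (rule card_0_eq) auto
  then show ?thesis
    by (auto simp: vec_eq_iff)
qed

text \<open>At \<open>X = Y = 1\<close> only the zero word survives on the left of the MacWilliams
  identity.\<close>

lemma card_code_dual:
  assumes "linear_code (B :: (bit ^ 'n) set)"
  shows "card B * card (dual_code B) = 2 ^ CARD('n)"
proof -
  have "int (card B * card (dual_code B)) = (\<Sum>d\<in>B. weight_monom 2 0 d)"
    using macwilliams_coset[OF assms, of 0 "1::int" 1] by (simp add: weight_monom_def)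
  also have "\<dots> = (\<Sum>d\<in>B. if d = 0 then 2 ^ CARD('n) else 0)"
    by (intro sum.cong) (auto simp: weight_monom_def power_0_left hamming_weight_eq_0_iff)
  also have "\<dots> = int (2 ^ CARD('n))"
    using assms by (simp add: linear_code_bit)
  finally show ?thesis
    by (simp only: of_nat_eq_iff)
qed

lemma dual_dual_code:
  assumes "linear_code (B :: (bit ^ 'n) set)"
  shows "dual_code (dual_code B) = B"
proof -
  have "B \<subseteq> dual_code (dual_code B)"
    by (auto simp: dual_code_def dot_commute)
  moreover have "card B * card (dual_code B) = card (dual_code (dual_code B)) * card (dual_code B)"
    using card_code_dual[OF assms] card_code_dual[OF linear_code_dual[of B]] by (simp add: mult.commute)
  then have "card B = card (dual_code (dual_code B))"
    using card_code_dual[OF assms] by (metis mult_cancel2 mult_0_right power_not_zero zero_neq_numeral)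
  ultimately show ?thesis
    by (metis card_subset_eq finite_bit_vec)
qed

section \<open>Overlaps of words and doubly even codes\<close>

definition ones :: "bit ^ 'n" where
  "ones = (\<chi> i. 1)"

lemma hamming_weight_ones: "hamming_weight (ones :: bit ^ 'n) = CARD('n)"
  by (simp add: hamming_weight_def ones_def)

lemma of_nat_bit: "(of_nat n :: bit) = (if even n then 0 else 1)"
  by (induction n) auto

lemma dot_bit: "dot x y = (of_nat (card {i. x $ i = 1 \<and> y $ i = 1}) :: bit)"
proof -
  have "dot x y = (\<Sum>i\<in>UNIV. if x $ i = 1 \<and> y $ i = 1 then 1 else 0)"
    unfolding dot_def
  proof (intro sum.cong refl)
    fix i show "x $ i * y $ i = (if x $ i = 1 \<and> y $ i = 1 then 1 else 0)"
      by (cases "x $ i"; cases "y $ i") auto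
  qed
  then show ?thesis
    by (simp add: sum.If_cases)
qed

lemma dot_ones: "dot x ones = (of_nat (hamming_weight x) :: bit)"
  by (simp add: dot_bit hamming_weight_def ones_def)

text \<open>The support of the sum is the symmetric difference of the supports. The additive form
  avoids truncated subtraction.\<close>

lemma hamming_weight_add:
  "hamming_weight (x + y) + 2 * card {i. x $ i = 1 \<and> y $ i = 1} = hamming_weight x + hamming_weight y"
proof -
  let ?A = "{i. x $ i = 1}" and ?B = "{i. y $ i = 1}"
  have bit: "(a + b = (1::bit)) = ((a = 1) \<noteq> (b = 1))" for a b
    by (cases a; cases b) auto
  have "{i. (x + y) $ i = 1} = (?A \<union> ?B) - (?A \<inter> ?B)"
    by (auto simp: bit)
  then have "hamming_weight (x + y) = card (?A \<union> ?B) - card (?A \<inter> ?B)"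
    unfolding hamming_weight_def by (simp add: card_Diff_subset le_infI1)
  moreover have "card (?A \<union> ?B) + card (?A \<inter> ?B) = hamming_weight x + hamming_weight y"
    unfolding hamming_weight_def by (simp add: card_Un_Int[symmetric])
  moreover have "card (?A \<inter> ?B) \<le> card (?A \<union> ?B)"
    by (intro card_mono) auto
  moreover have "?A \<inter> ?B = {i. x $ i = 1 \<and> y $ i = 1}"
    by auto
  ultimately show ?thesis
    by simp
qed

lemma doubly_even_add:
  assumes "4 dvd hamming_weight x" "4 dvd hamming_weight y" "dot x y = 0"
  shows "4 dvd hamming_weight (x + y)"
proof -
  have "even (card {i. x $ i = 1 \<and> y $ i = 1})"
    using assms(3) by (auto simp: dot_bit of_nat_bit split: if_splits)
  then have "4 dvd 2 * card {i. x $ i = 1 \<and> y $ i = 1}"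
    by auto
  moreover have "4 dvd hamming_weight (x + y) + 2 * card {i. x $ i = 1 \<and> y $ i = 1}"
    using assms by (simp add: hamming_weight_add)
  ultimately show ?thesis
    by (simp add: dvd_add_left_iff)
qed

text \<open>By \<open>hamming_weight_add\<close> twice the overlap is divisible by 4, so the overlap
  is even.\<close>

lemma doubly_even_dot:
  assumes "doubly_even B" "x \<in> B" "y \<in> B"
  shows "dot x y = 0"
proof -
  have "x + y \<in> B"
    using assms by (auto simp: doubly_even_def linear_code_bit)
  then have "4 dvd hamming_weight (x + y)" "4 dvd hamming_weight x" "4 dvd hamming_weight y"
    using assms by (auto simp: doubly_even_def)
  then have "even (card {i. x $ i = 1 \<and> y $ i = 1})"
    using hamming_weight_add[of x y] by presburger
  then show ?thesis
    by (simp add: dot_bit of_nat_bit)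
qed

lemma doubly_even_subset_dual: "doubly_even B \<Longrightarrow> B \<subseteq> dual_code B"
  using doubly_even_dot by (auto simp: dual_code_def)

text \<open>The union is the span of \<open>B\<close> and \<open>x\<close>; this is the extension
  step behind maximal doubly even codes.\<close>

lemma doubly_even_adjoin:
  assumes B: "doubly_even B" and x: "x \<in> dual_code B" "4 dvd hamming_weight x"
  shows "doubly_even (B \<union> (+) x ` B)"
proof -
  have add: "y + z \<in> B" if "y \<in> B" "z \<in> B" for y z
    using B that by (auto simp: linear_code_bit doubly_even_def)
  have img: "w \<in> (+) x ` B \<longleftrightarrow> x + w \<in> B" for w
    by (metis bit_vec_add_cancel imageE image_eqI)
  have "u + v \<in> B \<union> (+) x ` B" if "u \<in> B \<union> (+) x ` B" "v \<in> B \<union> (+) x ` B" for u v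
  proof -
    have "x + u \<in> B \<Longrightarrow> x + v \<in> B \<Longrightarrow> u + v \<in> B"
      using add[of "x + u" "x + v"] bit_vec_add_cancel[of x "u + v"] by (simp add: ac_simps)
    then show ?thesis
      using that add[of u v] add[of "x + u" v] add[of u "x + v"]
      by (auto simp: img ac_simps)
  qed
  then have "linear_code (B \<union> (+) x ` B)"
    using B by (simp add: linear_code_bit doubly_even_def)
  moreover have "4 dvd hamming_weight (x + y)" if "y \<in> B" for y
    using B x that by (intro doubly_even_add) (auto simp: dual_code_def doubly_even_def)
  ultimately show ?thesis
    using B by (auto simp: doubly_even_def)
qed

text \<open>Both \<open>1 + \<i>\<close> and \<open>1 - \<i>\<close> have fourth power
  \<open>-4\<close>, so all words contribute equally.\<close>

lemma sum_weight_monom_doubly_even: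
  fixes B :: "(bit ^ 'n) set"
  assumes "doubly_even B" "4 dvd CARD('n)"
  shows "(\<Sum>d\<in>B. weight_monom (1 + \<i>) (1 - \<i>) d) = of_nat (card B) * (- 4) ^ (CARD('n) div 4)"
proof -
  have "weight_monom (1 + \<i>) (1 - \<i>) d = (- 4) ^ (CARD('n) div 4)" if d: "d \<in> B" for d
  proof -
    obtain m where m: "hamming_weight d = 4 * m"
      using d assms(1) by (auto simp: doubly_even_def)
    obtain l where l: "CARD('n) = 4 * l"
      using assms(2) by auto
    have lm: "m \<le> l"
      using hamming_weight_le[of d] m l by simp
    have p: "(1 + \<i>) ^ 4 = - 4" "(1 - \<i>) ^ 4 = - 4"
      by (simp_all add: eval_nat_numeral algebra_simps)
    have "weight_monom (1 + \<i>) (1 - \<i>) d = (1 + \<i>) ^ (4 * (l - m)) * (1 - \<i>) ^ (4 * m)"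
      by (simp add: weight_monom_def m l diff_mult_distrib2)
    also have "\<dots> = (- 4) ^ (l - m) * (- 4) ^ m"
      by (simp only: power_mult p)
    also have "\<dots> = (- 4) ^ l"
      using lm by (simp flip: power_add)
    finally show ?thesis
      by (simp add: l)
  qed
  then show ?thesis
    by simp
qed

text \<open>
  The Gauss sum \<open>\<Sum>x\<in>dual_code D. \<i> ^ wt x\<close>: by the MacWilliams identity it equals the
  positive number \<open>4 ^ (n div 4)\<close>, and for a maximal doubly even \<open>D\<close> the words of the dual
  outside \<open>D\<close> each contribute \<open>-1\<close> to it.  So fewer than half of the words of the dual
  lie outside the subgroup \<open>D\<close>, hence none.
\<close>

lemma maximal_doubly_even_self_dual:
  fixes D :: "(bit ^ 'n) set"
  assumes D: "doubly_even D" and n: "8 dvd CARD('n)"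
    and max: "\<And>x. x \<in> dual_code D \<Longrightarrow> 4 dvd hamming_weight x \<Longrightarrow> x \<in> D"
  shows "self_dual D"
proof -
  have lin: "linear_code D"
    using D by (simp add: doubly_even_def)
  have n4: "4 dvd CARD('n)"
    using n by auto
  have D4: "even (hamming_weight x)" if "x \<in> D" for x
    using D that by (auto simp: doubly_even_def intro: dvd_trans[of 2 4])
  \<comment> \<open>Maximality puts the all-one word into \<open>D\<close>, which forces even
    weights throughout the dual.\<close>
  have "ones \<in> dual_code D"
    using D4 by (auto simp: dual_code_def dot_commute[of ones] dot_ones of_nat_bit)
  then have ones: "ones \<in> D"
    using n4 by (intro max) (auto simp: hamming_weight_ones)
  have even: "even (hamming_weight x)" if "x \<in> dual_code D" for x
    using that ones by (auto simp: dual_code_def dot_ones of_nat_bit split: if_splits)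
  have sub: "D \<subseteq> dual_code D"
    by (rule doubly_even_subset_dual) fact
  have i4: "\<i> ^ (4 * m) = 1" for m
    by (simp add: power_mult)
  have mono: "weight_monom 1 \<i> x = (if x \<in> D then 1 else - 1)" if x: "x \<in> dual_code D" for x
  proof (cases "x \<in> D")
    case True
    then obtain m where "hamming_weight x = 4 * m"
      using D by (auto simp: doubly_even_def)
    then show ?thesis
      using True by (simp add: weight_monom_def i4)
  next
    case False
    then have "\<not> 4 dvd hamming_weight x"
      using max x by blast
    with even[OF x] have "hamming_weight x = 4 * (hamming_weight x div 4) + 2"
      by presburger
    then obtain m where "hamming_weight x = 4 * m + 2"
      by blast
    then show ?thesis
      using False by (simp add: weight_monom_def i4 power_add)
  qed
  have pos: "card D > 0"
    using lin by (auto simp: linear_code_bit card_gt_0_iff)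
  have "of_nat (card D) * (\<Sum>x\<in>dual_code D. weight_monom 1 \<i> x) =
        (of_nat (card D) * (- 4) ^ (CARD('n) div 4) :: complex)"
    using macwilliams_coset[OF lin, of 0 1 \<i>]
    unfolding sum_weight_monom_doubly_even[OF D n4, symmetric] by (simp del: mult_cancel_left)
  then have "(\<Sum>x\<in>dual_code D. weight_monom 1 \<i> x) = (- 4) ^ (CARD('n) div 4)"
    using pos by (metis mult_cancel_left of_nat_0_eq_iff less_numeral_extra(3))
  \<comment> \<open>Divisibility of the length by 8 makes the exponent even.\<close>
  also have "\<dots> = 4 ^ (CARD('n) div 4)"
    using n by auto
  finally have "4 ^ (CARD('n) div 4) = (\<Sum>x\<in>dual_code D. if x \<in> D then 1 else - 1 :: complex)"
    using mono by simp
  also have "\<dots> = of_nat (card D) - of_nat (card (dual_code D - D))"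
    using sub by (simp add: sum.If_cases Int_absorb1 Diff_eq sum_negf)
  finally have "complex_of_real (4 ^ (CARD('n) div 4)) = complex_of_real (real (card D) - real (card (dual_code D - D)))"
    by simp
  then have "4 ^ (CARD('n) div 4) = real (card D) - real (card (dual_code D - D))"
    by (simp only: of_real_eq_iff)
  moreover have "(4::real) ^ (CARD('n) div 4) > 0"
    by simp
  ultimately have less: "card (dual_code D - D) < card D"
    by linarith
  have "x \<in> D" if x: "x \<in> dual_code D" for x
  proof (rule ccontr)
    assume xD: "x \<notin> D"
    \<comment> \<open>The coset \<open>x + D\<close> lies outside \<open>D\<close> and is as large
      as \<open>D\<close>, against \<open>less\<close>.\<close>
    have "x + d \<in> dual_code D - D" if "d \<in> D" for d
    proof -
      have "x + d \<in> dual_code D"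
        using that x sub linear_code_dual[of D] by (auto simp: linear_code_bit)
      moreover have "x + d \<notin> D"
        using lin that xD unfolding linear_code_bit by (metis add.commute bit_vec_add_cancel)
      ultimately show ?thesis
        by simp
    qed
    then have "card ((+) x ` D) \<le> card (dual_code D - D)"
      by (intro card_mono) auto
    moreover have "card ((+) x ` D) = card D"
      by (intro card_image) (auto simp: inj_on_def)
    ultimately show False
      using less by simp
  qed
  then show ?thesis
    using sub lin by (auto simp: self_dual_def)
qed

text \<open>A maximal doubly even code over \<open>B\<close> exists by finiteness; by
  \<open>doubly_even_adjoin\<close> it contains every word of its dual whose weight is divisible by
  4.\<close>

lemma doubly_even_extends_self_dual:
  fixes B :: "(bit ^ 'n) set"
  assumes "doubly_even B" "8 dvd CARD('n)"
  obtains D where "B \<subseteq> D" "doubly_even D" "self_dual D"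
proof -
  let ?S = "{D. B \<subseteq> D \<and> doubly_even D}"
  have "finite ?S"
    by (rule finite_subset[of _ "Pow UNIV"]) (blast, simp del: Pow_UNIV)
  moreover have "B \<in> ?S"
    using assms by simp
  ultimately have "\<exists>D\<in>?S. B \<subseteq> D \<and> (\<forall>D'\<in>?S. D \<subseteq> D' \<longrightarrow> D = D')"
    by (rule finite_has_maximal2)
  then obtain D where D: "D \<in> ?S" "\<forall>D'\<in>?S. D \<subseteq> D' \<longrightarrow> D = D'"
    by (elim bexE conjE)
  have "x \<in> D" if "x \<in> dual_code D" "4 dvd hamming_weight x" for x
  proof -
    have "D \<union> (+) x ` D \<in> ?S"
      using D that doubly_even_adjoin[of D x] by auto
    then have "D = D \<union> (+) x ` D"
      using D(2) by (metis Un_upper1)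
    moreover have "x \<in> (+) x ` D"
      using D(1) by (auto simp: doubly_even_def linear_code_bit image_iff)
    ultimately show ?thesis
      by blast
  qed
  then have "self_dual D"
    using D(1) assms(2) by (intro maximal_doubly_even_self_dual) auto
  then show ?thesis
    using that D(1) by auto
qed

subsection \<open>Gleason's theorem\<close>

lemma poly_eqI_infinite:
  fixes p q :: "'a::idom poly"
  assumes "infinite A" "\<And>x. x \<in> A \<Longrightarrow> poly p x = poly q x"
  shows "p = q"
proof (rule ccontr)
  assume "p \<noteq> q"
  then have "finite {x. poly (p - q) x = 0}"
    by (intro poly_roots_finite) auto
  moreover have "A \<subseteq> {x. poly (p - q) x = 0}"
    using assms(2) by auto
  ultimately show False
    using assms(1) finite_subset by blast
qed

text \<open>
  \<open>P(t)\<close> stands for the homogeneous weight enumerator \<open>W(x, y)\<close> of degree \<open>24 m\<close> with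
  \<open>W(1, y) = P(y ^ 4)\<close>; the condition is \<open>W(x + y, x - y) = 2 ^ (12 m) W(x, y)\<close>, dehomogenised.
\<close>

definition macwilliams_invariant :: "nat \<Rightarrow> real poly \<Rightarrow> bool" where
  "macwilliams_invariant m P \<longleftrightarrow> degree P \<le> 6 * m \<and>
     (\<forall>y. y \<notin> {0, 1, -1} \<longrightarrow>
        (1 + y) ^ (24 * m) * poly P (((1 - y) / (1 + y)) ^ 4) = 2 ^ (12 * m) * poly P (y ^ 4))"

lemma macwilliams_invariantD:
  assumes "macwilliams_invariant m P" "y \<notin> {0, 1, -1}"
  shows "(1 + y) ^ (24 * m) * poly P (((1 - y) / (1 + y)) ^ 4) = 2 ^ (12 * m) * poly P (y ^ 4)"
  using assms unfolding macwilliams_invariant_def by blast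

text \<open>The invariance at \<open>y\<close> and at \<open>- y\<close> has the same right side,
  while the Moebius map sends these points to \<open>z\<close> and \<open>1 / z\<close>. In terms of
  the enumerator this is \<open>W(x, y) = W(y, x)\<close>.\<close>

lemma macwilliams_invariant_palindromic:
  assumes P: "macwilliams_invariant m P" and deg: "degree P = 6 * m"
  shows "reflect_poly P = P"
proof (rule poly_eqI_infinite)
  show "infinite {1<..<2::real}"
    by simp
next
  fix t :: real
  assume t: "t \<in> {1<..<2}"
  define z where "z = root 4 t"
  have z: "z > 1" "z ^ 4 = t"
    using t by (auto simp: z_def)
  \<comment> \<open>The Moebius map is an involution, so it sends this \<open>y\<close> back to
    \<open>z\<close>.\<close>
  define y where "y = (1 - z) / (1 + z)"
  have y: "y \<notin> {0, 1, -1}" "- y \<notin> {0, 1, -1}"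
    using z by (auto simp: y_def field_simps)
  have y1: "1 - y = z * (1 + y)" "1 + y \<noteq> 0" "1 - y \<noteq> 0"
    using z by (auto simp: y_def field_simps)
  then have yz: "(1 - y) / (1 + y) = z" "(1 + y) / (1 - y) = inverse z"
    using z by (auto simp: field_simps)
  have "(1 + y) ^ (24 * m) * poly P (z ^ 4) = (1 - y) ^ (24 * m) * poly P (inverse z ^ 4)"
    using macwilliams_invariantD[OF P y(1)] macwilliams_invariantD[OF P y(2)] by (simp add: yz)
  also have "\<dots> = (1 + y) ^ (24 * m) * (z ^ (24 * m) * poly P (inverse z ^ 4))"
    by (simp add: y1(1) power_mult_distrib)
  finally have "poly P (z ^ 4) = z ^ (24 * m) * poly P (inverse z ^ 4)"
    using y1 by simp
  also have "z ^ (24 * m) = (z ^ 4) ^ (6 * m)"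
    by (simp flip: power_mult)
  finally show "poly (reflect_poly P) t = poly P t"
    using t z by (simp add: poly_reflect_poly_nz deg power_inverse)
qed

lemma poly_sum_coeff:
  fixes p :: "'a::comm_semiring_1 poly"
  assumes "degree p \<le> n"
  shows "poly p x = (\<Sum>i\<le>n. coeff p i * x ^ i)"
proof -
  have "poly p x = (\<Sum>i\<le>degree p. coeff p i * x ^ i)"
    by (rule poly_altdef)
  also have "\<dots> = (\<Sum>i\<le>n. coeff p i * x ^ i)"
    using assms by (intro sum.mono_neutral_left) (auto simp: coeff_eq_0)
  finally show ?thesis .
qed

text \<open>In \<open>W(1 + y, 1 - y)\<close> the term of index \<open>i\<close> carries
  \<open>(1 - y) ^ (4 * i)\<close>, and the term \<open>i = 0\<close> vanishes.\<close>

lemma macwilliams_invariant_dvd_pcompose: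
  assumes P: "macwilliams_invariant m P" and P0: "coeff P 0 = 0"
  shows "[:-1, 1:] ^ 4 dvd pcompose P (monom 1 4)"
proof -
  have deg: "degree P \<le> 6 * m"
    using P by (simp add: macwilliams_invariant_def)
  \<comment> \<open>\<open>Q\<close> is \<open>W(1 + y, 1 - y)\<close> as a polynomial in
    \<open>y\<close>, with denominators cleared.\<close>
  define Q where "Q = (\<Sum>i\<le>6 * m. smult (coeff P i) ([:1, 1:] ^ (24 * m - 4 * i) * [:1, -1:] ^ (4 * i)))"
  have "Q = smult (2 ^ (12 * m)) (pcompose P (monom 1 4))"
  proof (rule poly_eqI_infinite)
    show "infinite {1<..<2::real}"
      by simp
  next
    fix y :: real
    assume y: "y \<in> {1<..<2}"
    have "poly Q y = (\<Sum>i\<le>6 * m. coeff P i * ((1 + y) ^ (24 * m - 4 * i) * (1 - y) ^ (4 * i)))"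
      by (simp add: Q_def poly_sum)
    also have "\<dots> = (\<Sum>i\<le>6 * m. (1 + y) ^ (24 * m) * (coeff P i * (((1 - y) / (1 + y)) ^ 4) ^ i))"
    proof (intro sum.cong refl)
      fix i assume "i \<in> {..6 * m}"
      then have "(1 + y) ^ (24 * m) = (1 + y) ^ (24 * m - 4 * i) * (1 + y) ^ (4 * i)"
        by (simp flip: power_add)
      then show "coeff P i * ((1 + y) ^ (24 * m - 4 * i) * (1 - y) ^ (4 * i)) =
                 (1 + y) ^ (24 * m) * (coeff P i * (((1 - y) / (1 + y)) ^ 4) ^ i)"
        using y by (simp add: power_divide flip: power_mult)
    qed
    also have "\<dots> = (1 + y) ^ (24 * m) * poly P (((1 - y) / (1 + y)) ^ 4)"
      by (simp add: poly_sum_coeff[OF deg] sum_distrib_left)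
    also have "\<dots> = 2 ^ (12 * m) * poly P (y ^ 4)"
      by (rule macwilliams_invariantD[OF P]) (use y in auto)
    finally show "poly Q y = poly (smult (2 ^ (12 * m)) (pcompose P (monom 1 4))) y"
      by (simp add: poly_pcompose poly_monom)
  qed
  moreover have "[:-1, 1:] ^ 4 dvd Q"
    unfolding Q_def
  proof (intro dvd_sum)
    fix i assume "i \<in> {..6 * m}"
    show "[:-1, 1:] ^ 4 dvd smult (coeff P i) ([:1, 1:] ^ (24 * m - 4 * i) * [:1, -1:] ^ (4 * i))"
    proof (cases "i = 0")
      case False
      have "[:1, -1:] ^ 4 dvd ([:1, -1:] ^ (4 * i) :: real poly)"
        using False by (intro le_imp_power_dvd) auto
      moreover have "[:1, -1:] ^ 4 = ([:-1, 1:] ^ 4 :: real poly)"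
        by (simp add: eval_nat_numeral)
      ultimately show ?thesis
        by (intro dvd_smult dvd_mult) simp
    qed (use P0 in simp)
  qed
  ultimately show ?thesis
    by (simp add: dvd_smult_iff)
qed

lemma pcompose_power: "pcompose (p ^ n) q = pcompose p q ^ n"
  by (induction n) (simp_all add: pcompose_mult one_pCons pcompose_const)

text \<open>Since \<open>y ^ 4 - 1\<close> is \<open>y - 1\<close> times a factor nonzero at 1, the
  substitution keeps the order of vanishing at 1.\<close>

lemma dvd_of_dvd_pcompose_power:
  assumes "[:-1, 1:] ^ n dvd pcompose P (monom 1 4)"
  shows "[:-1, 1:] ^ n dvd (P :: real poly)"
proof (cases "P = 0")
  case False
  let ?a = "order 1 P"
  obtain R where R: "P = [:-1, 1:] ^ ?a * R" "\<not> [:-1, 1:] dvd R"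
    using order_decomp[OF False, of 1] by auto
  have R1: "poly R 1 \<noteq> 0"
    using R(2) by (simp add: poly_eq_0_iff_dvd)
  define S where "S = [:1, 1, 1, 1:] ^ ?a * pcompose R (monom 1 4)"
  have S1: "poly S 1 \<noteq> 0"
    using R1 by (simp add: S_def poly_pcompose poly_monom)
  have "pcompose [:-1, 1:] (monom 1 4) = ([:-1, 1:] * [:1, 1, 1, 1:] :: real poly)"
    by (simp add: pcompose_pCons monom_altdef eval_nat_numeral)
  then have "pcompose P (monom 1 4) = [:-1, 1:] ^ ?a * S"
    by (subst R(1)) (simp only: pcompose_mult pcompose_power power_mult_distrib S_def mult.assoc)
  moreover have "S \<noteq> 0"
    using S1 by auto
  ultimately have "n \<le> order 1 ([:-1, 1:] ^ ?a * S)"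
    using assms by (simp add: order_divides)
  also have "\<dots> = ?a"
    using S1 \<open>S \<noteq> 0\<close> order_power_n_n[of 1 ?a] by (subst order_mult) (auto simp: order_0I)
  finally show ?thesis
    by (simp add: order_divides)
qed simp

text \<open>
  The generators of Gleason's ring in the variable \<open>t = y\<^sup>4\<close>:
  \<open>x\<^sup>8 + 14 x\<^sup>4 y\<^sup>4 + y\<^sup>8\<close> and \<open>x\<^sup>4 y\<^sup>4 (x\<^sup>4 - y\<^sup>4)\<^sup>4\<close>.
\<close>

definition hamming_poly :: "real poly" where
  "hamming_poly = [:1, 14, 1:]"

definition golay_poly :: "real poly" where
  "golay_poly = [:0, 1:] * [:-1, 1:] ^ 4"

lemma poly_hamming: "poly hamming_poly t = 1 + 14 * t + t ^ 2"
  by (simp add: hamming_poly_def algebra_simps power2_eq_square)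

lemma poly_golay: "poly golay_poly t = t * (t - 1) ^ 4"
  by (simp add: golay_poly_def)

lemma hamming_poly_transform:
  assumes "y \<noteq> -1"
  shows "(1 + y) ^ 8 * poly hamming_poly (((1 - y) / (1 + y)) ^ 4) = 2 ^ 4 * poly hamming_poly (y ^ 4)"
proof -
  define z where "z = (1 - y) / (1 + y)"
  have 1: "(1 + y) ^ 4 * z ^ 4 = (1 - y) ^ 4"
    using assms by (simp add: z_def power_divide)
  have "(1 + y) ^ 8 = ((1 + y) ^ 4) ^ 2"
    by (simp flip: power_mult)
  then have "(1 + y) ^ 8 * poly hamming_poly (z ^ 4) =
        ((1 + y) ^ 4) ^ 2 + 14 * ((1 + y) ^ 4 * ((1 + y) ^ 4 * z ^ 4)) + ((1 + y) ^ 4 * z ^ 4) ^ 2"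
    by (simp add: poly_hamming power2_eq_square distrib_left ac_simps)
  \<comment> \<open>With \<open>a = (1 + y) ^ 4\<close> and \<open>b = (1 - y) ^ 4\<close> this
    rewrites \<open>a ^ 2 + 14 * a * b + b ^ 2\<close> through \<open>a + b\<close> and
    \<open>a * b\<close>, which are polynomials in \<open>y ^ 2\<close>.\<close>
  also have "\<dots> = ((1 + y) ^ 4 + (1 - y) ^ 4) ^ 2 + 12 * ((1 + y) ^ 4 * (1 - y) ^ 4)"
    unfolding 1 by (simp add: power2_sum)
  also have "(1 + y) ^ 4 + (1 - y) ^ 4 = 2 * (1 + 6 * y ^ 2 + (y ^ 2) ^ 2)"
    by algebra
  also have "(1 + y) ^ 4 * (1 - y) ^ 4 = ((1 + y) * (1 - y)) ^ 4"
    by (simp only: power_mult_distrib)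
  also have "(1 + y) * (1 - y) = 1 - y ^ 2"
    by algebra
  also have "(2 * (1 + 6 * y ^ 2 + (y ^ 2) ^ 2)) ^ 2 + 12 * (1 - y ^ 2) ^ 4 = 2 ^ 4 * poly hamming_poly (y ^ 4)"
    unfolding poly_hamming by algebra
  finally show ?thesis
    by (simp add: z_def)
qed

lemma golay_poly_transform:
  assumes "y \<noteq> -1"
  shows "(1 + y) ^ 24 * poly golay_poly (((1 - y) / (1 + y)) ^ 4) = 2 ^ 12 * poly golay_poly (y ^ 4)"
proof -
  define z where "z = (1 - y) / (1 + y)"
  have 1: "(1 + y) ^ 4 * z ^ 4 = (1 - y) ^ 4"
    using assms by (simp add: z_def power_divide)
  then have 2: "(1 + y) ^ 4 * (z ^ 4 - 1) = - 8 * y * (1 + y ^ 2)"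
    by algebra
  have "(1 + y) ^ 24 = (1 + y) ^ 4 * (1 + y) ^ 4 * ((1 + y) ^ 4) ^ 4"
    by (simp flip: power_add power_mult)
  then have "(1 + y) ^ 24 * poly golay_poly (z ^ 4) =
        (1 + y) ^ 4 * ((1 + y) ^ 4 * z ^ 4) * ((1 + y) ^ 4 * (z ^ 4 - 1)) ^ 4"
    unfolding poly_golay power_mult_distrib by (simp only: ac_simps)
  also have "\<dots> = (1 + y) ^ 4 * (1 - y) ^ 4 * (- 8 * y * (1 + y ^ 2)) ^ 4"
    by (simp only: 1 2)
  also have "\<dots> = 2 ^ 12 * (y ^ 4 * ((1 + y) * (1 - y) * (1 + y ^ 2)) ^ 4)"
    by (simp add: power_mult_distrib)
  also have "(1 + y) * (1 - y) * (1 + y ^ 2) = - (y ^ 4 - 1)"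
    by algebra
  also have "(- (y ^ 4 - 1)) ^ 4 = (y ^ 4 - 1) ^ 4"
    by (rule power_minus_even) simp
  also have "2 ^ 12 * (y ^ 4 * (y ^ 4 - 1) ^ 4) = 2 ^ 12 * poly golay_poly (y ^ 4)"
    by (simp only: poly_golay)
  finally show ?thesis
    by (simp add: z_def)
qed

lemma degree_golay_poly: "degree golay_poly = 5"
  by (simp add: golay_poly_def degree_mult_eq degree_power_eq)

lemma golay_poly_nonzero [simp]: "golay_poly \<noteq> 0"
  by (simp add: golay_poly_def)

text \<open>An invariant with constant term 1, used in \<open>gleason\<close> to cancel constant
  terms.\<close>

lemma macwilliams_invariant_hamming: "macwilliams_invariant m (hamming_poly ^ (3 * m))"
proof -
  have "degree (hamming_poly ^ (3 * m)) \<le> 6 * m"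
    by (simp add: degree_power_eq hamming_poly_def)
  moreover have "(1 + y) ^ (24 * m) * poly hamming_poly (((1 - y) / (1 + y)) ^ 4) ^ (3 * m) =
        2 ^ (12 * m) * poly hamming_poly (y ^ 4) ^ (3 * m)" if "y \<noteq> -1" for y
  proof -
    have "((1 + y) ^ 8 * poly hamming_poly (((1 - y) / (1 + y)) ^ 4)) ^ (3 * m) =
          (2 ^ 4 * poly hamming_poly (y ^ 4)) ^ (3 * m)"
      by (simp only: hamming_poly_transform[OF that])
    then show ?thesis
      unfolding power_mult_distrib power_mult[symmetric] by (simp add: mult.assoc[symmetric])
  qed
  ultimately show ?thesis
    by (simp add: macwilliams_invariant_def)
qed

lemma macwilliams_invariant_diff:
  "macwilliams_invariant m P \<Longrightarrow> macwilliams_invariant m Q \<Longrightarrow> macwilliams_invariant m (P - smult c Q)"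
  unfolding macwilliams_invariant_def
  by (auto simp: algebra_simps intro!: degree_diff_le)

text \<open>The zero constant term gives the factor \<open>t\<close>, and the vanishing at 1 gives
  \<open>(t - 1) ^ 4\<close>.\<close>

lemma macwilliams_invariant_divide:
  assumes P: "macwilliams_invariant (Suc m) P" and P0: "coeff P 0 = 0"
  obtains Q where "P = golay_poly * Q" "macwilliams_invariant m Q"
proof (cases "P = 0")
  case True
  then show ?thesis
    using that[of 0] by (simp add: macwilliams_invariant_def)
next
  case False
  have "[:-1, 1:] ^ 4 dvd P"
    by (rule dvd_of_dvd_pcompose_power[OF macwilliams_invariant_dvd_pcompose[OF P P0]])
  then obtain R where R: "P = [:-1, 1:] ^ 4 * R"
    by blast
  have "poly P 0 = poly R 0"
    by (simp add: R)
  then have "[:0, 1:] dvd R"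
    using P0 poly_eq_0_iff_dvd[of R 0] by (simp add: poly_0_coeff_0)
  then obtain Q where Q: "R = [:0, 1:] * Q"
    by blast
  have PQ: "P = golay_poly * Q"
    by (simp only: R Q golay_poly_def ac_simps)
  have Q0: "Q \<noteq> 0"
    using False PQ by auto
  \<comment> \<open>The degree bound must fall by 6 although \<open>golay_poly\<close> has degree 5.
    By palindromicity a coefficient in top degree would equal \<open>coeff P 0\<close>.\<close>
  have "degree P \<noteq> 6 * Suc m"
  proof
    assume "degree P = 6 * Suc m"
    then have "lead_coeff P = coeff P 0"
      using macwilliams_invariant_palindromic[OF P] by (metis coeff_0_reflect_poly)
    then show False
      using P0 False by simp
  qed
  then have "degree P < 6 * Suc m"
    using P by (simp add: macwilliams_invariant_def)
  then have "degree Q \<le> 6 * m"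
    using Q0 by (simp add: PQ degree_mult_eq degree_golay_poly)
  moreover have "(1 + y) ^ (24 * m) * poly Q (((1 - y) / (1 + y)) ^ 4) = 2 ^ (12 * m) * poly Q (y ^ 4)"
    if y: "y \<notin> {0, 1, -1}" for y
  proof -
    \<comment> \<open>The excluded points 0, 1 and -1 are the real zeros of
      \<open>poly golay_poly (y ^ 4)\<close>, which can therefore be cancelled.\<close>
    have "y ^ 4 - 1 = (y - 1) * (y + 1) * (y ^ 2 + 1)"
      by algebra
    moreover have "y ^ 2 + 1 \<noteq> 0"
      by (metis add.commute power_one sum_power2_eq_zero_iff zero_neq_one)
    ultimately have U: "poly golay_poly (y ^ 4) \<noteq> 0"
      using y by (auto simp: poly_golay eq_neg_iff_add_eq_0)
    have "(2 ^ 12 * poly golay_poly (y ^ 4)) * ((1 + y) ^ (24 * m) * poly Q (((1 - y) / (1 + y)) ^ 4)) =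
          ((1 + y) ^ 24 * poly golay_poly (((1 - y) / (1 + y)) ^ 4)) *
          ((1 + y) ^ (24 * m) * poly Q (((1 - y) / (1 + y)) ^ 4))"
      using y by (subst golay_poly_transform) auto
    also have "\<dots> = (1 + y) ^ (24 * Suc m) * poly P (((1 - y) / (1 + y)) ^ 4)"
      unfolding PQ poly_mult mult_Suc_right power_add by (simp only: ac_simps)
    also have "\<dots> = 2 ^ (12 * Suc m) * poly P (y ^ 4)"
      using macwilliams_invariantD[OF P y] .
    also have "\<dots> = (2 ^ 12 * poly golay_poly (y ^ 4)) * (2 ^ (12 * m) * poly Q (y ^ 4))"
      unfolding PQ poly_mult mult_Suc_right power_add by (simp only: ac_simps)
    finally show ?thesis
      using U by (metis mult_cancel_left mult_eq_0_iff power_eq_0_iff zero_neq_numeral)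
  qed
  ultimately show ?thesis
    using that[OF PQ] by (simp add: macwilliams_invariant_def)
qed

text \<open>Induction on \<open>m\<close>: cancel the constant term with a multiple of a power of
  \<open>hamming_poly\<close>, then divide by \<open>golay_poly\<close>.\<close>

theorem gleason:
  assumes "macwilliams_invariant m P"
  shows "\<exists>b. P = (\<Sum>j\<le>m. smult (b j) (hamming_poly ^ (3 * j) * golay_poly ^ (m - j)))"
  using assms
proof (induction m arbitrary: P)
  case 0
  then obtain c where "P = [:c:]"
    by (auto simp: macwilliams_invariant_def elim: degree_eq_zeroE)
  then show ?case
    by (auto intro!: exI[of _ "\<lambda>_. c"])
next
  case (Suc m)
  define P' where "P' = P - smult (coeff P 0) (hamming_poly ^ (3 * Suc m))"
  have inv: "macwilliams_invariant (Suc m) P'"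
    unfolding P'_def by (intro macwilliams_invariant_diff Suc.prems macwilliams_invariant_hamming)
  have "coeff (hamming_poly ^ (3 * Suc m)) 0 = 1"
    by (simp only: coeff_0_power) (simp add: hamming_poly_def)
  then have "coeff P' 0 = 0"
    by (simp add: P'_def)
  then obtain Q where Q: "P' = golay_poly * Q" "macwilliams_invariant m Q"
    using macwilliams_invariant_divide[OF inv] by blast
  obtain b where b: "Q = (\<Sum>j\<le>m. smult (b j) (hamming_poly ^ (3 * j) * golay_poly ^ (m - j)))"
    using Suc.IH[OF Q(2)] by blast
  have "golay_poly * Q = (\<Sum>j\<le>m. smult (b j) (hamming_poly ^ (3 * j) * golay_poly ^ (Suc m - j)))"
    unfolding b sum_distrib_left by (intro sum.cong) (auto simp: Suc_diff_le mult_ac)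
  then have "P = (\<Sum>j\<le>m. smult (b j) (hamming_poly ^ (3 * j) * golay_poly ^ (Suc m - j))) +
               smult (coeff P 0) (hamming_poly ^ (3 * Suc m))"
    using Q(1) by (simp add: P'_def algebra_simps)
  also have "\<dots> = (\<Sum>j\<le>Suc m. smult ((b(Suc m := coeff P 0)) j)
                    (hamming_poly ^ (3 * j) * golay_poly ^ (Suc m - j)))"
    by simp
  finally show ?case
    by blast
qed

section \<open>Formal residues, positivity of coefficients and the gap bound\<close>

lemma fls_residue_sum: "fls_residue (\<Sum>j\<in>A. f j) = (\<Sum>j\<in>A. fls_residue (f j))"
  by (induction A rule: infinite_finite_induct) auto

text \<open>The series is a constant multiple of the derivative of \<open>f ^ Suc j\<close>, and
  derivatives have residue 0.\<close>

lemma fls_residue_power_times_deriv: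
  fixes f :: "'a::field_char_0 fls"
  shows "fls_residue (f ^ j * fls_deriv f) = 0"
proof -
  have "of_int (int (Suc j)) * (f ^ j * fls_deriv f) = fls_deriv (f ^ Suc j)"
    by (simp only: fls_deriv_power of_int_of_nat_eq diff_Suc_1 mult.assoc)
  then have "of_int (int (Suc j)) * fls_residue (f ^ j * fls_deriv f) = 0"
    by (simp only: fls_residue_of_int_times(1)[symmetric] fls_residue_deriv)
  then show ?thesis
    by (simp only: mult_eq_0_iff of_int_of_nat_eq of_nat_eq_0_iff) simp
qed

text \<open>Integration by parts: the two sides differ by the residue of the derivative of
  \<open>v * i ^ Suc m\<close>.\<close>

lemma fls_residue_power_times_deriv_mult:
  fixes v i :: "'a::field_char_0 fls"
  shows "of_nat (Suc m) * fls_residue (i ^ m * fls_deriv (v * i)) =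
         of_nat m * fls_residue (fls_deriv v * i ^ Suc m)"
proof -
  have "of_int (int (Suc m)) * (i ^ m * fls_deriv (v * i)) =
        fls_deriv (v * i ^ Suc m) + of_int (int m) * (fls_deriv v * i ^ Suc m)"
    unfolding fls_deriv_mult[of v] fls_deriv_power by (simp add: algebra_simps)
  then have "fls_residue (of_int (int (Suc m)) * (i ^ m * fls_deriv (v * i))) =
        fls_residue (of_int (int m) * (fls_deriv v * i ^ Suc m))"
    by (simp only: fls_residue_add fls_residue_deriv add_0_left)
  then show ?thesis
    by (simp only: fls_residue_of_int_times) (simp only: of_int_of_nat_eq)
qed

abbreviation geometric :: "real fps" where
  "geometric \<equiv> Abs_fps (\<lambda>_. 1)"

lemma geometric_mult: "geometric * (1 - fps_X) = 1"
  using inverse_mult_eq_1'[of geometric] by (simp add: fps_inverse_gp')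

text \<open>Multiplying by \<open>geometric\<close> turns coefficients into partial sums, each at
  least the positive constant term.\<close>

lemma fps_nth_mult_geometric:
  fixes f :: "real fps"
  assumes "\<And>n. fps_nth f n \<ge> 0" "fps_nth f 0 > 0"
  shows "fps_nth (f * geometric ^ k) n \<ge> 0 \<and> (k > 0 \<longrightarrow> fps_nth (f * geometric ^ k) n > 0)"
proof (induction k arbitrary: n)
  case 0
  show ?case
    using assms(1) by simp
next
  case (Suc k)
  let ?h = "f * geometric ^ k"
  have "fps_nth (f * geometric ^ Suc k) n = fps_nth (?h * geometric) n"
    by (simp add: mult_ac)
  also have "\<dots> = (\<Sum>i=0..n. fps_nth ?h i)"
    by (simp add: fps_mult_nth)
  finally have eq: "fps_nth (f * geometric ^ Suc k) n = (\<Sum>i=0..n. fps_nth ?h i)" .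
  have "fps_nth ?h 0 = fps_nth f 0"
    by (simp add: fps_power_zeroth)
  then have "0 < fps_nth ?h 0"
    using assms(2) by simp
  also have "\<dots> \<le> (\<Sum>i=0..n. fps_nth ?h i)"
    using Suc.IH by (intro member_le_sum) auto
  finally show ?case
    unfolding eq by simp
qed

text \<open>
  With \<open>E = hamming_poly\<close>, \<open>U = golay_poly\<close> and \<open>J = E\<^sup>3 / U\<close>, Gleason's theorem makes
  \<open>P / U ^ m\<close> a polynomial in \<open>J\<close>, so \<open>(P / U ^ m) dJ\<close> is exact and has residue \<open>0\<close> at \<open>t = 0\<close>.
  If \<open>P = 1 + O(t ^ (m + 2))\<close>, this residue is that of \<open>dJ / U ^ m\<close>, which after
  integration by parts is a positive multiple of the coefficient of \<open>t ^ m\<close> in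
  \<open>(E\<^sup>3)' / (1 - t) ^ (4 (m + 1))\<close>, a series with positive coefficients.
\<close>

theorem macwilliams_invariant_gap:
  assumes inv: "macwilliams_invariant m P" and m: "m > 0" and P0: "coeff P 0 = 1"
  shows "\<exists>i\<in>{1..m + 1}. coeff P i \<noteq> 0"
proof (rule ccontr)
  assume "\<not> ?thesis"
  then have gap: "coeff P i = 0" if "i \<in> {1..m + 1}" for i
    using that by blast
  define L where "L = (\<lambda>p :: real poly. fps_to_fls (fps_of_poly p))"
  have L_mult: "L (p * q) = L p * L q" and L_power: "L (p ^ n) = L p ^ n"
    and L_add: "L (p + q) = L p + L q" for p q n
    by (simp_all add: L_def fps_of_poly_mult fps_of_poly_power fps_of_poly_add
        fls_times_fps_to_fls fps_to_fls_power)
  have L_smult: "L (smult c p) = fls_const c * L p" for c p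
    by (simp add: L_def fps_of_poly_smult fls_times_fps_to_fls)
  have L_sum: "L (\<Sum>j\<in>A. f j) = (\<Sum>j\<in>A. L (f j))" for f and A :: "nat set"
    by (induction A rule: infinite_finite_induct) (simp_all add: L_add, simp_all add: L_def)
  define v u where "v = L (hamming_poly ^ 3)" and "u = L golay_poly"
  \<comment> \<open>\<open>G\<close> is \<open>1 / (1 - t) ^ 4\<close> and \<open>i\<close> is
    \<open>1 / u\<close>, so \<open>v * i\<close> is \<open>J\<close>.\<close>
  define G where "G = fps_to_fls (geometric ^ 4)"
  define i where "i = fls_X_inv * G"
  have "[:-1, 1:] ^ 4 = ([:1, -1:] ^ 4 :: real poly)"
    by (simp add: eval_nat_numeral)
  then have "L ([:-1, 1:] ^ 4) = fps_to_fls ((1 - fps_X) ^ 4)"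
    by (simp add: L_def fps_of_poly_power fps_of_poly_linear')
  then have "G * L ([:-1, 1:] ^ 4) = fps_to_fls ((geometric * (1 - fps_X)) ^ 4)"
    by (simp only: G_def power_mult_distrib fls_times_fps_to_fls)
  then have G: "G * L ([:-1, 1:] ^ 4) = 1"
    by (simp add: geometric_mult)
  have "L [:0, 1:] = fls_X"
    by (simp add: L_def)
  then have "u * i = (fls_X * fls_X_inv) * (G * L ([:-1, 1:] ^ 4))"
    by (simp only: u_def i_def golay_poly_def L_mult ac_simps)
  moreover have X: "fls_X * fls_X_inv = (1 :: real fls)"
    using fls_X_inv_power_times_conv_shift(2)[of fls_X 1] by simp
  ultimately have ui: "u * i = 1"
    by (simp add: G)
  have Xi: "fls_X * i = G"
    by (simp add: i_def mult.assoc[symmetric] X)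
  let ?dJ = "fls_deriv (v * i)"

  obtain b where b: "P = (\<Sum>j\<le>m. smult (b j) (hamming_poly ^ (3 * j) * golay_poly ^ (m - j)))"
    using gleason[OF inv] by blast
  \<comment> \<open>Each summand of Gleason's expansion becomes a constant multiple of
    \<open>J ^ j dJ\<close>.\<close>
  have "L P * i ^ m * ?dJ = (\<Sum>j\<le>m. fls_const (b j) * ((v * i) ^ j * ?dJ))"
    unfolding b L_sum sum_distrib_right
  proof (intro sum.cong refl)
    fix j assume "j \<in> {..m}"
    then have "i ^ m = i ^ (m - j) * i ^ j"
      by (simp flip: power_add)
    then have "u ^ (m - j) * i ^ m = (u * i) ^ (m - j) * i ^ j"
      by (simp only: power_mult_distrib mult.assoc)
    then have "u ^ (m - j) * i ^ m = i ^ j"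
      by (simp add: ui)
    then show "L (smult (b j) (hamming_poly ^ (3 * j) * golay_poly ^ (m - j))) * i ^ m * ?dJ =
               fls_const (b j) * ((v * i) ^ j * ?dJ)"
      by (simp add: L_smult L_mult L_power power_mult v_def u_def power_mult_distrib mult.assoc)
  qed
  then have res0: "fls_residue (L P * i ^ m * ?dJ) = 0"
    by (simp only: fls_residue_sum fls_residue_fls_const_times fls_residue_power_times_deriv) simp

  define R where "R = poly_shift (m + 2) P"
  have X_power: "[:0, 1:] ^ (m + 2) = (monom 1 (m + 2) :: real poly)"
    by (simp add: monom_altdef)
  have "P = 1 + [:0, 1:] ^ (m + 2) * R"
  proof (rule poly_eqI)
    fix n
    consider "n = 0" | "n \<in> {1..m + 1}" | "n \<ge> m + 2"
      by force
    then show "coeff P n = coeff (1 + [:0, 1:] ^ (m + 2) * R) n"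
      unfolding X_power by cases (use P0 gap in \<open>auto simp: R_def coeff_monom_mult coeff_poly_shift intro!: arg_cong[where f = "coeff P"]\<close>)
  qed
  then have LP: "L P = 1 + fls_X ^ (m + 2) * L R"
    by (simp only: L_add L_mult L_power \<open>L [:0, 1:] = fls_X\<close>) (simp add: L_def)
  have di: "fls_X * fls_deriv i = fls_deriv G - i"
    using arg_cong[OF Xi, of fls_deriv] by (simp add: algebra_simps)
  \<comment> \<open>The poles of \<open>i ^ m\<close> and \<open>dJ\<close> have orders
    \<open>m\<close> and 2, so \<open>fls_X ^ (m + 2)\<close> clears both and the tail of
    \<open>P\<close> contributes no residue.\<close>
  have "fls_X ^ (m + 2) * L R * i ^ m * ?dJ = L R * (fls_X * i) ^ m * (fls_X ^ 2 * ?dJ)"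
    by (simp only: power_mult_distrib power_add ac_simps)
  also have "fls_X ^ 2 * ?dJ = fls_X * fls_deriv v * (fls_X * i) + v * (fls_X * (fls_X * fls_deriv i))"
    by (simp add: algebra_simps power2_eq_square)
  also have "\<dots> = fls_X * fls_deriv v * G + v * (fls_X * fls_deriv G - G)"
    by (simp add: Xi di algebra_simps)
  finally have "fls_X ^ (m + 2) * L R * i ^ m * ?dJ =
      L R * G ^ m * (fls_X * fls_deriv v * G + v * (fls_X * fls_deriv G - G))"
    by (simp only: Xi)
  also have "\<exists>f. \<dots> = fps_to_fls f"
    unfolding L_def v_def G_def fls_deriv_fps_to_fls fps_X_to_fls[symmetric] fps_to_fls_power[symmetric]
      fls_times_fps_to_fls[symmetric] fps_to_fls_plus[symmetric] fps_to_fls_minus[symmetric]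
    by blast
  finally have "fls_residue (fls_X ^ (m + 2) * L R * i ^ m * ?dJ) = 0"
    by auto
  then have "fls_residue (i ^ m * ?dJ) = 0"
    using res0 by (simp add: LP algebra_simps)
  \<comment> \<open>Positivity of \<open>m\<close> lets the factor \<open>of_nat m\<close> be
    cancelled.\<close>
  then have "fls_residue (fls_deriv v * i ^ Suc m) = 0"
    using fls_residue_power_times_deriv_mult[of m i v] m by simp
  moreover define f where "f = fps_deriv (fps_of_poly (hamming_poly ^ 3))"
  have "G ^ Suc m = fps_to_fls (geometric ^ (4 * Suc m))"
    by (simp only: G_def power_mult fps_to_fls_power)
  then have "fls_deriv v * i ^ Suc m = fls_X_inv ^ Suc m * fps_to_fls (f * geometric ^ (4 * Suc m))"
    by (simp only: v_def L_def fls_deriv_fps_to_fls f_def i_def power_mult_distrib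
        fls_times_fps_to_fls ac_simps)
  then have "fls_residue (fls_deriv v * i ^ Suc m) = fps_nth (f * geometric ^ (4 * Suc m)) m"
    by (simp add: fls_X_inv_power_times_conv_shift del: power_Suc)
  moreover have "fps_nth f n \<ge> 0 \<and> fps_nth f 0 > 0" for n
  proof -
    \<comment> \<open>All coefficients are positive, and the derivative has constant term
      42.\<close>
    have "hamming_poly ^ 3 = [:1, 42, 591, 2828, 591, 42, 1:]"
      by (simp add: hamming_poly_def eval_nat_numeral)
    then show ?thesis
      by (auto simp: f_def coeff_pCons split: nat.splits)
  qed
  then have "fps_nth (f * geometric ^ (4 * Suc m)) m > 0"
    using fps_nth_mult_geometric[of f "4 * Suc m" m] by simp
  ultimately show False
    by simp
qed

text \<open>A factor \<open>t\<close> changes neither side. Otherwise differentiation removes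
  exactly the constant term and lowers the order at 1 by at most one.\<close>

lemma order_less_card_coeffs:
  fixes p :: "real poly"
  assumes "p \<noteq> 0"
  shows "order 1 p < card {i. coeff p i \<noteq> 0}"
  using assms
proof (induction "degree p" arbitrary: p rule: less_induct)
  case less
  have fin: "finite {i. coeff q i \<noteq> 0}" for q :: "real poly"
    by (rule finite_subset[of _ "{..degree q}"]) (auto intro: le_degree)
  show ?case
  proof (cases "degree p = 0")
    case True
    then obtain c where "p = [:c:]" "c \<noteq> 0"
      using less.prems by (auto elim: degree_eq_zeroE)
    then have "order 1 p = 0" "0 \<in> {i. coeff p i \<noteq> 0}"
      by (auto simp: order_0I)
    then show ?thesis
      using fin[of p] by (auto simp: card_gt_0_iff)
  next
    case deg: False
    show ?thesis
    proof (cases "coeff p 0 = 0")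
      case True
      then obtain q where q: "p = pCons 0 q"
        by (cases p) auto
      have "q \<noteq> 0"
        using less.prems q by auto
      then have "order 1 q < card {i. coeff q i \<noteq> 0}"
        using q by (intro less.hyps) auto
      moreover have "order 1 p = order 1 q"
        using \<open>q \<noteq> 0\<close> order_mult[of "[:0, 1:]" q 1] by (simp add: q order_0I)
      moreover have "{i. coeff p i \<noteq> 0} = Suc ` {i. coeff q i \<noteq> 0}"
        by (auto simp: q coeff_pCons image_iff gr0_conv_Suc split: nat.splits)
      ultimately show ?thesis
        by (simp add: card_image)
    next
      case False
      have d: "pderiv p \<noteq> 0"
        using deg by (simp add: pderiv_eq_0_iff)
      then have "order 1 (pderiv p) < card {i. coeff (pderiv p) i \<noteq> 0}"
        using deg by (intro less.hyps) (auto simp: degree_pderiv)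
      moreover have "order 1 p \<le> Suc (order 1 (pderiv p))"
        using order_pderiv[OF less.prems, of 1] order_0I[of p 1] by (cases "poly p 1 = 0") auto
      moreover have "{i. coeff p i \<noteq> 0} = insert 0 (Suc ` {i. coeff (pderiv p) i \<noteq> 0})"
        using False by (auto simp: coeff_pderiv image_iff) (metis not0_implies_Suc)
      ultimately show ?thesis
        using fin[of "pderiv p"] by (simp add: card_image)
    qed
  qed
qed

subsection \<open>Doubly even self-dual codes\<close>

lemma self_dual_card:
  fixes D :: "(bit ^ 'n) set"
  assumes "self_dual D" "CARD('n) = 2 * l"
  shows "card D = 2 ^ l"
proof -
  have "card D * card D = 2 ^ CARD('n)"
    using card_code_dual[of D] assms by (simp add: self_dual_def)
  then have "card D ^ 2 = (2 ^ l) ^ 2"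
    by (simp add: assms(2) power2_eq_square power_add mult_2)
  then show ?thesis
    by (simp add: power2_eq_iff_nonneg)
qed

lemma doubly_even_ones:
  assumes "doubly_even D" "self_dual D"
  shows "ones \<in> D"
proof -
  have "ones \<in> dual_code D"
    using assms(1) by (auto simp: dual_code_def doubly_even_def dot_commute[of ones] dot_ones of_nat_bit
        intro: dvd_trans[of 2 4])
  then show ?thesis
    using assms(2) by (simp add: self_dual_def)
qed

section \<open>Weight enumerators and the bounds of Mallows-Sloane and Delsarte\<close>

definition weight_poly :: "(bit ^ 'n) set \<Rightarrow> real poly" where
  "weight_poly D = (\<Sum>d\<in>D. monom 1 (hamming_weight d div 4))"

text \<open>The MacWilliams identity at \<open>X = 1\<close>, \<open>Y = y\<close>, for a code that
  is its own dual and has \<open>2 ^ (12 * k)\<close> words.\<close>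

lemma macwilliams_invariant_weight_poly:
  fixes D :: "(bit ^ 'n) set"
  assumes D: "doubly_even D" "self_dual D" and n: "CARD('n) = 24 * k"
  shows "macwilliams_invariant k (weight_poly D)"
proof -
  have wt: "hamming_weight d = 4 * (hamming_weight d div 4)" if "d \<in> D" for d
    using D(1) that by (auto simp: doubly_even_def)
  have le: "hamming_weight d div 4 \<le> 6 * k" for d :: "bit ^ 'n"
    using hamming_weight_le[of d] n by simp
  have "degree (weight_poly D) \<le> 6 * k"
    unfolding weight_poly_def using le by (intro degree_sum_le) (auto simp: degree_monom_eq)
  moreover have "(1 + y) ^ (24 * k) * poly (weight_poly D) (((1 - y) / (1 + y)) ^ 4) =
      2 ^ (12 * k) * poly (weight_poly D) (y ^ 4)" if y: "y \<notin> {0, 1, -1}" for y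
  proof -
    have y1: "1 + y \<noteq> 0"
      using y by auto
    have "(1 + y) ^ (24 * k) * poly (weight_poly D) (((1 - y) / (1 + y)) ^ 4) =
          (\<Sum>d\<in>D. (1 + y) ^ (24 * k) * (((1 - y) / (1 + y)) ^ 4) ^ (hamming_weight d div 4))"
      by (simp add: weight_poly_def poly_sum poly_monom sum_distrib_left)
    also have "\<dots> = (\<Sum>d\<in>D. weight_monom (1 + y) (1 - y) d)"
    proof (intro sum.cong refl)
      fix d assume d: "d \<in> D"
      have "(((1 - y) / (1 + y)) ^ 4) ^ (hamming_weight d div 4) = ((1 - y) / (1 + y)) ^ hamming_weight d"
        using wt[OF d] by (simp flip: power_mult)
      moreover have "(1 + y) ^ (24 * k) = (1 + y) ^ (24 * k - hamming_weight d) * (1 + y) ^ hamming_weight d"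
        using hamming_weight_le[of d] n by (simp flip: power_add)
      ultimately show "(1 + y) ^ (24 * k) * (((1 - y) / (1 + y)) ^ 4) ^ (hamming_weight d div 4) =
          weight_monom (1 + y) (1 - y) d"
        using y1 by (simp add: weight_monom_def n power_divide)
    qed
    also have "\<dots> = real (card D) * (\<Sum>d\<in>D. weight_monom 1 y d)"
      using macwilliams_coset[of D 0 1 y] D(2) by (simp add: self_dual_def)
    also have "real (card D) = 2 ^ (12 * k)"
      using self_dual_card[OF D(2), of "12 * k"] n by simp
    also have "(\<Sum>d\<in>D. weight_monom 1 y d) = poly (weight_poly D) (y ^ 4)"
      unfolding weight_poly_def poly_sum
      using wt by (intro sum.cong refl) (simp add: weight_monom_def poly_monom flip: power_mult)
    finally show ?thesis .
  qed
  ultimately show ?thesis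
    by (simp add: macwilliams_invariant_def)
qed

lemma self_dual_zero: "self_dual D \<Longrightarrow> 0 \<in> D"
  by (auto simp: self_dual_def dual_code_def)

text \<open>The gap theorem gives a nonzero coefficient of \<open>weight_poly D\<close> at an index
  from 1 to \<open>k + 1\<close>, and coefficients count words.\<close>

theorem mallows_sloane:
  fixes D :: "(bit ^ 'n) set"
  assumes D: "doubly_even D" "self_dual D" and n: "CARD('n) = 24 * k" and k: "k > 0"
  shows "\<exists>d\<in>D. d \<noteq> 0 \<and> hamming_weight d \<le> 4 * k + 4"
proof -
  have wt: "hamming_weight d = 4 * (hamming_weight d div 4)" if "d \<in> D" for d
    using D(1) that by (auto simp: doubly_even_def)
  have coeff: "coeff (weight_poly D) i = real (card {d \<in> D. hamming_weight d div 4 = i})" for i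
    by (simp add: weight_poly_def coeff_sum coeff_monom sum.If_cases Int_def)
  have "d = 0" if "d \<in> D" "hamming_weight d div 4 = 0" for d
    using wt[OF that(1)] that(2) by (metis hamming_weight_eq_0_iff mult_0_right)
  then have "{d \<in> D. hamming_weight d div 4 = 0} = {0}"
    using self_dual_zero[OF D(2)] by auto
  then have "coeff (weight_poly D) 0 = 1"
    by (simp only: coeff) simp
  then obtain i where i: "i \<in> {1..k + 1}" "coeff (weight_poly D) i \<noteq> 0"
    using macwilliams_invariant_gap[OF macwilliams_invariant_weight_poly[OF D n] k] by blast
  then have "card {d \<in> D. hamming_weight d div 4 = i} \<noteq> 0"
    by (metis coeff of_nat_0)
  then obtain d where d: "d \<in> D" "hamming_weight d div 4 = i"
    by (metis (mono_tags, lifting) card.empty empty_Collect_eq)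
  then have "d \<noteq> 0" "hamming_weight d \<le> 4 * k + 4"
    using i wt[OF d(1)] by auto
  then show ?thesis
    using d by blast
qed

lemma hamming_weight_add_ones:
  "hamming_weight (x + ones) = CARD('n) - hamming_weight (x :: bit ^ 'n)"
  using hamming_weight_add[of x ones] hamming_weight_le[of x]
  by (simp add: hamming_weight_ones) (simp add: hamming_weight_def ones_def)

lemma bit_sign_poly: "(bit_sign b :: real poly) = [:bit_sign b:]"
  by (cases b) (simp_all add: one_pCons)

lemma smult_sum_right: "smult c (\<Sum>x\<in>A. f x) = (\<Sum>x\<in>A. smult c (f x))"
  by (induction A rule: infinite_finite_induct) (simp_all add: smult_add_right)

text \<open>
  If the coset \<open>x + D\<close> had no word of weight at most \<open>4k\<close>, then by the MacWilliams identity the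
  polynomial \<open>\<Sum>d\<in>D. (-1) ^ (d \<cdot> x) q ^ wt d\<close> would vanish to order at least \<open>4k + 1\<close> at \<open>q = 1\<close>,
  although it has at most \<open>4k + 1\<close> terms.
\<close>

theorem delsarte_bound:
  fixes D :: "(bit ^ 'n) set"
  assumes D: "doubly_even D" "self_dual D" and n: "CARD('n) = 24 * k"
    and min: "\<And>d. d \<in> D \<Longrightarrow> d \<noteq> 0 \<Longrightarrow> hamming_weight d \<ge> 4 * k + 4"
  shows "\<exists>v. v + x \<in> D \<and> hamming_weight v \<le> 4 * k"
proof (rule ccontr)
  assume "\<not> ?thesis"
  then have far: "hamming_weight v \<ge> 4 * k + 1" if "v + x \<in> D" for v
    using that by force
  have dual: "dual_code D = D" and lin: "linear_code D"
    using D(2) by (auto simp: self_dual_def)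
  define F where "F = (\<Sum>d\<in>D. monom (bit_sign (dot d x)) (hamming_weight d) :: real poly)"

  \<comment> \<open>The two arguments are 2 and \<open>2 * q\<close>, so each word yields
    \<open>2 ^ CARD('n)\<close> times a power of \<open>q\<close>.\<close>
  have "smult (2 ^ CARD('n)) F =
        (\<Sum>d\<in>D. bit_sign (dot d x) * weight_monom ([:1, 1:] + [:1, -1:]) ([:1, 1:] - [:1, -1:]) d)"
    unfolding F_def smult_sum_right
  proof (intro sum.cong refl)
    fix d :: "bit ^ 'n"
    have "weight_monom [:2:] [:0, 2:] d = monom (2 ^ (CARD('n) - hamming_weight d) * 2 ^ hamming_weight d :: real) (hamming_weight d)"
    proof -
      have "[:0, 2:] = monom (2::real) 1"
        by (simp add: monom_altdef)
      then show ?thesis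
        by (simp add: weight_monom_def monom_power poly_const_pow smult_monom)
    qed
    also have "\<dots> = monom (2 ^ CARD('n)) (hamming_weight d)"
      using hamming_weight_le[of d] by (simp flip: power_add)
    finally show "smult (2 ^ CARD('n)) (monom (bit_sign (dot d x)) (hamming_weight d)) =
        bit_sign (dot d x) * weight_monom ([:1, 1:] + [:1, -1:]) ([:1, 1:] - [:1, -1:] :: real poly) d"
      by (simp add: bit_sign_poly smult_monom mult.commute)
  qed
  also have "\<dots> = of_nat (card D) * (\<Sum>v\<in>{v. v + x \<in> D}. weight_monom [:1, 1:] [:1, -1:] v)"
    using macwilliams_coset[OF lin, of x "[:1, 1:] :: real poly" "[:1, -1:]"] by (simp only: dual)
  finally have eq: "smult (2 ^ CARD('n)) F =
      of_nat (card D) * (\<Sum>v\<in>{v. v + x \<in> D}. weight_monom [:1, 1:] [:1, -1:] v)" .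
  have "[:-1, 1:] ^ (4 * k + 1) dvd (weight_monom [:1, 1:] [:1, -1:] v :: real poly)" if "v + x \<in> D" for v
  proof -
    have "[:-1, 1:] dvd ([:1, -1:] :: real poly)"
      by (rule dvdI[of _ _ "-1"]) simp
    then have "[:-1, 1:] ^ (4 * k + 1) dvd ([:1, -1:] ^ hamming_weight v :: real poly)"
      using far[OF that] by (rule dvd_power_le)
    then show ?thesis
      by (simp add: weight_monom_def dvd_mult del: power_Suc)
  qed
  then have "[:-1, 1:] ^ (4 * k + 1) dvd smult (2 ^ CARD('n)) F"
    unfolding eq by (intro dvd_mult dvd_sum) auto
  then have dvd: "[:-1, 1:] ^ (4 * k + 1) dvd F"
    by (simp add: dvd_smult_iff del: power_Suc)

  have coeff: "coeff F i = (\<Sum>d\<in>{d \<in> D. hamming_weight d = i}. bit_sign (dot d x))" for i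
    by (simp add: F_def coeff_sum coeff_monom sum.If_cases Int_def)
  have "{d \<in> D. hamming_weight d = 0} = {0}"
    using self_dual_zero[OF D(2)] by (auto simp: hamming_weight_eq_0_iff)
  then have "coeff F 0 = 1"
    by (simp only: coeff) simp
  then have F0: "F \<noteq> 0"
    by auto
  then have "4 * k + 1 \<le> order 1 F"
    using dvd by (simp add: order_divides del: power_Suc)
  also have "\<dots> < card {i. coeff F i \<noteq> 0}"
    by (rule order_less_card_coeffs[OF F0])
  \<comment> \<open>Adding \<open>ones\<close> turns the lower bound \<open>4 * k + 4\<close> into
    the upper bound \<open>20 * k - 4\<close>. Besides 0 and \<open>24 * k\<close> this leaves
    \<open>4 * k - 1\<close> multiples of 4 when \<open>k\<close> is positive.\<close>
  also have "\<dots> \<le> card ({0, 24 * k} \<union> (*) 4 ` {k + 1..<5 * k})"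
  proof (intro card_mono subsetI)
    fix i assume "i \<in> {i. coeff F i \<noteq> 0}"
    then have "{d \<in> D. hamming_weight d = i} \<noteq> {}"
      by (metis (mono_tags, lifting) coeff mem_Collect_eq sum.empty)
    then obtain d where d: "d \<in> D" "hamming_weight d = i"
      by blast
    show "i \<in> {0, 24 * k} \<union> (*) 4 ` {k + 1..<5 * k}"
    proof (cases "d = 0 \<or> d + ones = 0")
      case True
      then have "d = 0 \<or> d = ones"
        by (metis add.right_neutral bit_vec_add_cancel)
      then show ?thesis
        using d n by (auto simp: hamming_weight_ones)
    next
      case False
      have "d + ones \<in> D"
        using lin d doubly_even_ones[OF D] by (auto simp: linear_code_bit)
      then have "4 * k + 4 \<le> 24 * k - i"
        using min[of "d + ones"] False d n by (simp add: hamming_weight_add_ones)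
      moreover have "4 * k + 4 \<le> i"
        using min[OF d(1)] False d by simp
      moreover have "4 dvd i"
        using D(1) d by (auto simp: doubly_even_def)
      ultimately have "i = 4 * (i div 4)" "i div 4 \<in> {k + 1..<5 * k}"
        by auto
      then show ?thesis
        by blast
    qed
  qed auto
  also have "\<dots> \<le> card {0, 24 * k} + card ((*) 4 ` {k + 1..<5 * k})"
    by (rule card_Un_le)
  also have "\<dots> \<le> 2 + (4 * k - 1)"
    by (intro add_mono order.trans[OF card_image_le]) (auto simp: card_insert_if)
  finally show False
    \<comment> \<open>For \<open>k = 0\<close> the truncated \<open>4 * k - 1\<close> gives no
      contradiction, but then the length would be 0.\<close>
    by (cases k) (use n in auto)
qed

subsection \<open>Residue codes of self-dual quaternary codes\<close>

lemma UNIV_z4: "(UNIV :: z4 set) = {0, 1, 2, 3}"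
proof -
  have "card {0, 1, 2, 3 :: z4} = CARD(z4)"
    by simp
  then show ?thesis
    by (metis card_eq_UNIV_imp_eq_UNIV finite)
qed

lemma z4_cases [case_names 0 1 2 3]:
  fixes a :: z4
  obtains "a = 0" | "a = 1" | "a = 2" | "a = 3"
  using UNIV_z4 by blast

lemma mod2_numeral: "mod2 (numeral w) = of_int (numeral w mod 4)"
  by (simp add: mod2_def bit0.Rep_numeral)

lemma mod2_add: "mod2 (a + b) = mod2 a + mod2 b"
  by (cases a rule: z4_cases; cases b rule: z4_cases) (simp_all add: mod2_numeral)

definition twice :: "bit \<Rightarrow> z4" where
  "twice b = (if b = 0 then 0 else 2)"

lemma twice_0 [simp]: "twice 0 = 0" and twice_1 [simp]: "twice 1 = 2"
  by (simp_all add: twice_def)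

lemma twice_eq_0_iff: "twice b = 0 \<longleftrightarrow> b = 0"
  by (cases b) simp_all

lemma twice_add: "twice (a + b) = twice a + twice b"
  by (cases a; cases b) simp_all

lemma twice_sum: "twice (\<Sum>i\<in>A. f i) = (\<Sum>i\<in>A. twice (f i))"
  by (induction A rule: infinite_finite_induct) (simp_all add: twice_add)

text \<open>In \<open>z4\<close> the product \<open>2 * a\<close> depends only on the parity of
  \<open>a\<close>. This makes doubling adjoint to reduction in
  \<open>dot_twice_vec\<close>.\<close>

lemma twice_mult_mod2: "twice (b * mod2 a) = twice b * a"
  by (cases a rule: z4_cases; cases b) simp_all

definition residue :: "z4 ^ 'n \<Rightarrow> bit ^ 'n" where
  "residue c = (\<chi> i. mod2 (c $ i))"

definition twice_vec :: "bit ^ 'n \<Rightarrow> z4 ^ 'n" where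
  "twice_vec y = (\<chi> i. twice (y $ i))"

lemma residue_code_image: "residue_code C = residue ` C"
  by (simp add: residue_code_def residue_def)

lemma residue_add: "residue (x + y) = residue x + residue y"
  by (simp add: residue_def vec_eq_iff mod2_add)

lemma residue_0 [simp]: "residue 0 = 0"
  by (simp add: residue_def vec_eq_iff)

lemma dot_twice_vec: "dot (twice_vec y) c = twice (dot y (residue c))"
  by (simp add: dot_def twice_vec_def residue_def twice_sum twice_mult_mod2)

lemma twice_vec_eq_0_iff: "twice_vec y = 0 \<longleftrightarrow> y = 0"
  by (simp add: twice_vec_def vec_eq_iff twice_eq_0_iff)

lemma lee_weight_twice_vec: "lee_weight (twice_vec y) = 2 * hamming_weight y"
proof -
  have "twice b \<noteq> 1" "twice b \<noteq> 3" "twice b = 2 \<longleftrightarrow> b \<noteq> 0" for b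
    by (cases b; simp)+
  then show ?thesis
    by (simp add: lee_weight_def num_comps_def twice_vec_def hamming_weight_def)
qed

lemma linear_code_residue_code:
  assumes "linear_code C"
  shows "linear_code (residue_code C)"
proof -
  have "0 \<in> C" and add: "\<And>x y. x \<in> C \<Longrightarrow> y \<in> C \<Longrightarrow> x + y \<in> C"
    using assms unfolding linear_code_def module.subspace_def[OF module_vector_scalar_mult] by auto
  have "0 \<in> residue ` C"
    using \<open>0 \<in> C\<close> by (rule image_eqI[rotated]) simp
  then show ?thesis
    using add unfolding linear_code_bit residue_code_image by (auto simp flip: residue_add)
qed

text \<open>As \<open>C\<close> is its own dual, membership of \<open>twice_vec y\<close> means
  orthogonality to \<open>C\<close>, which \<open>dot_twice_vec\<close> transfers to the
  residues.\<close>

lemma mem_dual_residue_code: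
  assumes "self_dual C"
  shows "y \<in> dual_code (residue_code C) \<longleftrightarrow> twice_vec y \<in> C"
proof -
  have "twice_vec y \<in> C \<longleftrightarrow> twice_vec y \<in> dual_code C"
    using assms by (simp add: self_dual_def)
  then show ?thesis
    by (simp add: dual_code_def residue_code_image dot_twice_vec twice_eq_0_iff)
qed

text \<open>Squares in \<open>z4\<close> are 1 at odd and 0 at even entries, so the product counts
  odd entries modulo 4.\<close>

lemma dot_self_z4: "dot c c = (of_nat (hamming_weight (residue c)) :: z4)"
proof -
  have sq: "a * a = (if mod2 a \<noteq> 0 then 1 else 0)" for a :: z4
    by (cases a rule: z4_cases) simp_all
  show ?thesis
    unfolding dot_def sq by (simp add: sum.If_cases hamming_weight_def residue_def)
qed

lemma doubly_even_residue_code: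
  assumes "self_dual C"
  shows "doubly_even (residue_code C)"
proof -
  have "4 dvd hamming_weight (residue c)" if "c \<in> C" for c
  proof -
    have "c \<in> dual_code C"
      using assms that by (simp add: self_dual_def)
    then have "(of_nat (hamming_weight (residue c)) :: z4) = 0"
      using that dot_self_z4[of c] by (simp add: dual_code_def)
    then show ?thesis
      by (simp add: of_nat_eq_0_iff_char_dvd)
  qed
  then show ?thesis
    using assms linear_code_residue_code[of C]
    by (auto simp: doubly_even_def self_dual_def residue_code_image)
qed

lemma finite_z4_vec: "finite (C :: (z4 ^ 'n) set)"
  by (rule finite_subset[OF subset_UNIV]) (rule finite)

theorem theorem3p1:
  fixes k :: nat and C :: "(z4 ^ 'n) set"
  assumes "k > 0"
    and "CARD('n) = 24 * k"
    and "self_dual C"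
    and "min_lee_weight C = 8 * k + 4 \<or> min_lee_weight C = 8 * k + 2"
  shows "self_dual (residue_code C) \<and> doubly_even (residue_code C) \<and> extremal (residue_code C)"
proof -
  let ?B = "residue_code C"
  have lin: "linear_code ?B"
    using assms(3) by (simp add: self_dual_def linear_code_residue_code)
  have B: "doubly_even ?B"
    by (rule doubly_even_residue_code) fact
  then obtain D where D: "?B \<subseteq> D" "doubly_even D" "self_dual D"
    using doubly_even_extends_self_dual[of ?B] assms(2) by auto
  \<comment> \<open>Either hypothesis bounds the Lee weight \<open>2 * hamming_weight y\<close> of
    \<open>twice_vec y\<close> below by \<open>8 * k + 2\<close>.\<close>
  have torsion: "hamming_weight y \<ge> 4 * k + 1" if y: "y \<in> dual_code ?B" "y \<noteq> 0" for y
  proof -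
    have "twice_vec y \<in> C - {0}"
      using y assms(3) by (simp add: mem_dual_residue_code twice_vec_eq_0_iff)
    then have "min_lee_weight C \<le> lee_weight (twice_vec y)"
      unfolding min_lee_weight_def by (intro Min_le) (auto simp: finite_z4_vec)
    then show ?thesis
      using assms(4) by (auto simp: lee_weight_twice_vec)
  qed
  have sub: "D \<subseteq> dual_code ?B"
    using D doubly_even_subset_dual[OF D(2)] by (auto simp: dual_code_def)
  \<comment> \<open>The weight is a multiple of 4 exceeding \<open>4 * k\<close>.\<close>
  have min: "hamming_weight d \<ge> 4 * k + 4" if "d \<in> D" "d \<noteq> 0" for d
  proof -
    have "hamming_weight d \<ge> 4 * k + 1" "4 dvd hamming_weight d"
      using that sub torsion D(2) by (auto simp: doubly_even_def)
    then show ?thesis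
      by presburger
  qed
  have "x \<in> D" if x: "x \<in> dual_code ?B" for x
  proof -
    obtain v where v: "v + x \<in> D" "hamming_weight v \<le> 4 * k"
      using delsarte_bound[OF D(2,3) assms(2) min] by blast
    \<comment> \<open>In characteristic 2 this sum is \<open>v\<close>, whose weight is too small
      for a nonzero word of the dual.\<close>
    have "(v + x) + x \<in> dual_code ?B"
      using v(1) x sub linear_code_dual[of ?B] unfolding linear_code_bit by blast
    then have "v \<in> dual_code ?B"
      by (simp add: add.assoc)
    then have "v = 0"
      using torsion[of v] v(2) by auto
    then show ?thesis
      using v(1) by simp
  qed
  then have "dual_code ?B = D"
    using sub by blast
  then have "?B = D"
    using dual_dual_code[OF lin] D(3) by (simp add: self_dual_def)
  then have sd: "self_dual ?B"
    using D(3) by simp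
  obtain d where d: "d \<in> D" "d \<noteq> 0" "hamming_weight d \<le> 4 * k + 4"
    using mallows_sloane[OF D(2,3) assms(2,1)] by blast
  have "hamming_weight d = 4 * k + 4"
    using d min[of d] by simp
  then have "Min (hamming_weight ` (D - {0})) = 4 * k + 4"
    using d min by (intro Min_eqI) (auto intro!: image_eqI[of _ _ d])
  then have "extremal ?B"
    using sd assms(2) by (simp add: extremal_def min_hamming_weight_def \<open>?B = D\<close>)
  then show ?thesis
    using sd B by blast
qed

end
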